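(* Let $k\ge 0$ be an integer and let $f=(f_0,\dots,f_k)^T$ be a vector whose components form a basis of the space $P_k$ of polynomials of degree at most $k$. Let $T\in GL(k+1,\mathbb{R})$ be the matrix satisfying $f(x)=T(1,x,\ldots,x^k)^T$. Then any fractel $w$ of $f$ is of the form $$w(x,y)=(l(x),\,T M_l T^{-1}y),$$ where $l\in\mathcal{S}$, $l(x)=\sigma x+\tau$, and the matrix $M_l\in\mathbb{R}^{(k+1)\times(k+1)}$ has the components $$m_{s,t}=\begin{cases}\binom{s}{t}\tau^{s-t}\sigma^t, & 0\le t\le s\le k,\\ 0,&\text{else,}\end{cases}\qquad s,t\in\{0,\dots,k\}.$$
   Context: Polynomials in $P_k$ are real polynomials regarded as functions $[0,1]\to\mathbb{R}$. $\mathcal{S}=\{l : l(x)=\sigma x+\tau,\ l([0,1])\subset[0,1]\}$ is the set of affine maps leaving $[0,1]$ invariant. A (linear) fractel of a function $f:[0,1]\to\mathbb{R}^m$ is a map $w:[0,1]\times\mathbb{R}^m\to[0,1]\times\mathbb{R}^m$ of the form $w(x,y)=(l(x),My)$ with $M\in\mathbb{R}^{m\times m}$ and $l(x)=\sigma x+\tau$, where either $\sigma\in(0,1]$ and $\tau\in[0,1-\sigma]$, or $\sigma\in[-1,0)$ and $\tau\in[|\sigma|,1]$, that maps the graph $G(f)=\{(x,f(x)) : x\in[0,1]\}$ into itself; equivalently, $f(l(x))=Mf(x)$ for all $x\in[0,1]$. Here $m=k+1$. The convention $0^0=1$ is used. *)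

theory Defs
  imports
    "Jordan_Normal_Form.Gauss_Jordan_Elimination"
    "HOL-Computational_Algebra.Polynomial"
    "HOL-Library.Function_Algebras"
begin

text \<open>
  Vectors and matrices over the reals are those of \<^theory>\<open>Jordan_Normal_Form.Matrix\<close>; their
  indices start at 0, so that size \<open>k + 1\<close> means indices \<open>0, \<dots>, k\<close>.

  A function \<open>[0,1] \<rightarrow> \<real>\<^sup>m\<close> is a HOL function \<open>real \<Rightarrow> real vec\<close> mapping \<open>{0..1}\<close> into
  \<open>carrier_vec m\<close>; its values outside \<open>{0..1}\<close> are never used.
\<close>

definition fun_scale :: "real \<Rightarrow> (real \<Rightarrow> real) \<Rightarrow> real \<Rightarrow> real" where
  "fun_scale c g = (\<lambda>x. c * g x)"

interpretation real_fun: vector_space fun_scale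
  by unfold_locales (auto simp: fun_scale_def fun_eq_iff algebra_simps)

text \<open>
  The vector space of all functions \<open>[0,1] \<rightarrow> \<real>\<close> is identified with the subspace of
  \<open>real \<Rightarrow> real\<close> formed by the functions that vanish outside \<open>{0..1}\<close>.
\<close>

definition on_unit :: "(real \<Rightarrow> real) \<Rightarrow> real \<Rightarrow> real" where
  "on_unit g = (\<lambda>x. if x \<in> {0..1} then g x else 0)"

definition poly_space :: "nat \<Rightarrow> (real \<Rightarrow> real) set" where
  "poly_space k = {on_unit (poly p) | p. degree p \<le> k}"

definition component :: "(real \<Rightarrow> real vec) \<Rightarrow> nat \<Rightarrow> real \<Rightarrow> real" where
  "component f i = on_unit (\<lambda>x. f x $ i)"

text \<open>The components are a basis as a family: \<open>inj_on\<close> excludes repetitions.\<close>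

definition components_form_basis :: "nat \<Rightarrow> (real \<Rightarrow> real vec) \<Rightarrow> (real \<Rightarrow> real) set \<Rightarrow> bool" where
  "components_form_basis m f V \<longleftrightarrow>
     inj_on (component f) {..<m} \<and>
     real_fun.independent (component f ` {..<m}) \<and>
     real_fun.span (component f ` {..<m}) = V"

definition unit_affine_maps :: "(real \<Rightarrow> real) set" where
  "unit_affine_maps = {l. (\<exists>\<sigma> \<tau>. \<forall>x. l x = \<sigma> * x + \<tau>) \<and> l ` {0..1} \<subseteq> {0..1}}"

definition graph_of :: "(real \<Rightarrow> real vec) \<Rightarrow> (real \<times> real vec) set" where
  "graph_of f = {(x, f x) | x. x \<in> {0..1}}"

text \<open>Only the values of \<open>w\<close> on \<open>[0,1] \<times> \<real>\<^sup>m\<close> matter.\<close>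

definition fractel :: "nat \<Rightarrow> (real \<Rightarrow> real vec) \<Rightarrow> (real \<times> real vec \<Rightarrow> real \<times> real vec) \<Rightarrow> bool" where
  "fractel m f w \<longleftrightarrow>
     (\<exists>\<sigma> \<tau>. \<exists>M \<in> carrier_mat m m.
        (\<sigma> \<in> {0<..1} \<and> \<tau> \<in> {0..1 - \<sigma>} \<or> \<sigma> \<in> {-1..<0} \<and> \<tau> \<in> {\<bar>\<sigma>\<bar>..1}) \<and>
        (\<forall>x \<in> {0..1}. \<forall>y \<in> carrier_vec m. w (x, y) = (\<sigma> * x + \<tau>, M *\<^sub>v y))) \<and>
     w ` graph_of f \<subseteq> graph_of f"

definition monomials :: "nat \<Rightarrow> real \<Rightarrow> real vec" where
  "monomials k x = vec (k + 1) (\<lambda>i. x ^ i)"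

definition GL :: "nat \<Rightarrow> real mat set" where
  "GL n = {A \<in> carrier_mat n n. invertible_mat A}"

text \<open>\<open>mat_inverse\<close> returns an option; on \<open>GL n\<close> it is never \<open>None\<close>.\<close>

definition inv_mat :: "real mat \<Rightarrow> real mat" where
  "inv_mat A = the (mat_inverse A)"

definition M_aff :: "nat \<Rightarrow> real \<Rightarrow> real \<Rightarrow> real mat" where
  "M_aff k \<sigma> \<tau> = mat (k + 1) (k + 1)
     (\<lambda>(s, t). if t \<le> s then real (s choose t) * \<tau> ^ (s - t) * \<sigma> ^ t else 0)"

end

theory Submission
  imports Defs
begin

text \<open>
  A fractel of \<open>f\<close> means \<open>f (l x) = M *\<^sub>v f x\<close> on \<open>[0,1]\<close>. With \<open>f = T *\<^sub>v monomials k\<close> and the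
  binomial theorem this reads \<open>(M * T) *\<^sub>v monomials k x = (T * M_aff k \<sigma> \<tau>) *\<^sub>v monomials k x\<close>.
  Each row is an identity of polynomials at infinitely many points, so the two matrices are equal,
  and cancelling \<open>T\<close> determines \<open>M\<close>.
\<close>

lemma M_aff_carrier: "M_aff k \<sigma> \<tau> \<in> carrier_mat (k + 1) (k + 1)"
  by (simp add: M_aff_def)

lemma monomials_carrier: "monomials k x \<in> carrier_vec (k + 1)"
  by (simp add: monomials_def)

lemma mult_monomials_index:
  assumes "A \<in> carrier_mat n (k + 1)" "i < n"
  shows "(A *\<^sub>v monomials k x) $ i = (\<Sum>j\<le>k. A $$ (i, j) * x ^ j)"
  using assms
  by (auto simp: monomials_def scalar_prod_def atLeast0LessThan lessThan_Suc_atMost intro!: sum.cong)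

text \<open>By the binomial theorem, row \<open>s\<close> of \<open>M_aff\<close> lists the
  coefficients of \<open>(\<sigma> * x + \<tau>) ^ s\<close> in powers of \<open>x\<close>. So the
  matrix represents substitution of the affine map in the monomial basis; the convention
  \<open>0 ^ 0 = 1\<close> covers vanishing \<sigma> or \<tau>.\<close>

lemma M_aff_mult_monomials: "M_aff k \<sigma> \<tau> *\<^sub>v monomials k x = monomials k (\<sigma> * x + \<tau>)"
proof (rule eq_vecI)
  fix s assume "s < dim_vec (monomials k (\<sigma> * x + \<tau>))"
  then have s: "s \<le> k" by (simp add: monomials_def)
  have "(M_aff k \<sigma> \<tau> *\<^sub>v monomials k x) $ s = (\<Sum>t\<le>k. M_aff k \<sigma> \<tau> $$ (s, t) * x ^ t)"
    using s by (intro mult_monomials_index[OF M_aff_carrier]) simp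
  \<comment> \<open>Entries above the diagonal vanish, so the row sum takes the range of a binomial
    expansion.\<close>
  also have "\<dots> = (\<Sum>t\<le>s. M_aff k \<sigma> \<tau> $$ (s, t) * x ^ t)"
    using s by (intro sum.mono_neutral_right) (auto simp: M_aff_def)
  also have "\<dots> = (\<Sum>t\<le>s. real (s choose t) * (\<sigma> * x) ^ t * \<tau> ^ (s - t))"
    using s by (intro sum.cong) (auto simp: M_aff_def power_mult_distrib)
  also have "\<dots> = (\<sigma> * x + \<tau>) ^ s"
    by (simp add: binomial_ring)
  finally show "(M_aff k \<sigma> \<tau> *\<^sub>v monomials k x) $ s = monomials k (\<sigma> * x + \<tau>) $ s"
    using s by (simp add: monomials_def)
qed (simp add: M_aff_def monomials_def)

text \<open>The entries of a row of \<open>A - B\<close> are the coefficients of a polynomial of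
  degree at most \<open>k\<close> that vanishes on \<open>X\<close>; if one of them were nonzero,
  there would be only finitely many roots.\<close>

lemma mat_eq_if_mult_monomials_eq:
  assumes A: "A \<in> carrier_mat n (k + 1)" and B: "B \<in> carrier_mat n (k + 1)"
    and "infinite X"
    and eq: "\<And>x. x \<in> X \<Longrightarrow> A *\<^sub>v monomials k x = B *\<^sub>v monomials k x"
  shows "A = B"
proof (rule eq_matI)
  fix i j assume "i < dim_row B" "j < dim_col B"
  then have i: "i < n" and j: "j \<le> k" using B by auto
  let ?c = "\<lambda>j. A $$ (i, j) - B $$ (i, j)"
  have "X \<subseteq> {x. (\<Sum>j\<le>k. ?c j * x ^ j) = 0}"
  proof
    fix x assume "x \<in> X"
    from arg_cong[OF eq[OF this], of "\<lambda>v. v $ i"]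
    show "x \<in> {x. (\<Sum>j\<le>k. ?c j * x ^ j) = 0}"
      by (simp add: mult_monomials_index[OF A i] mult_monomials_index[OF B i]
          left_diff_distrib sum_subtractf)
  qed
  then have "infinite {x. (\<Sum>j\<le>k. ?c j * x ^ j) = 0}"
    using \<open>infinite X\<close> finite_subset by blast
  then show "A $$ (i, j) = B $$ (i, j)"
    using polyfun_rootbound[of ?c j k] j by auto
qed (use A B in auto)

text \<open>\<open>mat_inverse\<close> is specified through the units of the matrix ring: it yields
  \<open>None\<close> only for a non-unit. Hence \<open>invertible_mat\<close> is first translated
  into membership in \<open>Units\<close>.\<close>

lemma inv_mat_GL:
  assumes "A \<in> GL n"
  shows "inv_mat A \<in> carrier_mat n n" "A * inv_mat A = 1\<^sub>m n"
proof -
  from assms have A: "A \<in> carrier_mat n n" and "invertible_mat A"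
    by (auto simp: GL_def)
  then obtain B where AB: "A * B = 1\<^sub>m n" and BA: "B * A = 1\<^sub>m (dim_row B)"
    by (auto simp: invertible_mat_def inverts_mat_def)
  \<comment> \<open>\<open>invertible_mat\<close> does not state the size of \<open>B\<close>;
    counting the columns of \<open>A * B\<close> and of \<open>B * A\<close> gives its column and
    row dimensions.\<close>
  have "B \<in> carrier_mat n n"
    using A arg_cong[OF AB, of dim_col] arg_cong[OF BA, of dim_col] by auto
  then have "A \<in> Units (ring_mat TYPE(real) n ())"
    using A AB BA by (auto simp: Units_def ring_mat_def)
  then obtain C where "mat_inverse A = Some C"
    using mat_inverse(1)[OF A, of "()"] by (cases "mat_inverse A") auto
  then show "inv_mat A \<in> carrier_mat n n" "A * inv_mat A = 1\<^sub>m n"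
    using mat_inverse(2)[OF A] by (auto simp: inv_mat_def)
qed

theorem proposition6p5:
  fixes k :: nat
    and f :: "real \<Rightarrow> real vec"
    and T :: "real mat"
    and w :: "real \<times> real vec \<Rightarrow> real \<times> real vec"
  assumes f_maps: "f \<in> {0..1} \<rightarrow> carrier_vec (k + 1)"
    and basis: "components_form_basis (k + 1) f (poly_space k)"
    and T_GL: "T \<in> GL (k + 1)"
    and T_eq: "\<forall>x \<in> {0..1}. f x = T *\<^sub>v monomials k x"
    and w: "fractel (k + 1) f w"
  shows "\<exists>l \<in> unit_affine_maps. \<exists>\<sigma> \<tau>.
           (\<forall>x. l x = \<sigma> * x + \<tau>) \<and>
           (\<forall>x \<in> {0..1}. \<forall>y \<in> carrier_vec (k + 1).
              w (x, y) = (l x, (T * M_aff k \<sigma> \<tau> * inv_mat T) *\<^sub>v y))"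
proof -
  from w obtain \<sigma> \<tau> M where M: "M \<in> carrier_mat (k + 1) (k + 1)"
    and \<sigma>\<tau>: "\<sigma> \<in> {0<..1} \<and> \<tau> \<in> {0..1 - \<sigma>} \<or> \<sigma> \<in> {-1..<0} \<and> \<tau> \<in> {\<bar>\<sigma>\<bar>..1}"
    and w_eq: "\<And>x y. x \<in> {0..1} \<Longrightarrow> y \<in> carrier_vec (k + 1) \<Longrightarrow> w (x, y) = (\<sigma> * x + \<tau>, M *\<^sub>v y)"
    and graph: "w ` graph_of f \<subseteq> graph_of f"
    unfolding fractel_def by blast
  have T: "T \<in> carrier_mat (k + 1) (k + 1)"
    using T_GL by (simp add: GL_def)
  define l where "l x = \<sigma> * x + \<tau>" for x
  have l_unit: "l x \<in> {0..1}" if "x \<in> {0..1}" for x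
  proof -
    \<comment> \<open>The product lies between 0 and \<sigma> for either sign of \<sigma>. These
      bounds leave a linear problem in \<sigma> and \<tau>, settled by the two admissible parameter
      ranges.\<close>
    have "min 0 \<sigma> \<le> \<sigma> * x" "\<sigma> * x \<le> max 0 \<sigma>"
      using that mult_left_le[of x \<sigma>] mult_left_le[of x "- \<sigma>"]
      by (auto simp: min_def max_def mult_nonneg_nonneg mult_nonpos_nonneg)
    then show ?thesis
      using \<sigma>\<tau> unfolding l_def greaterThanAtMost_iff atLeastLessThan_iff atLeastAtMost_iff
      by linarith
  qed
  then have l: "l \<in> unit_affine_maps"
    by (auto simp: unit_affine_maps_def l_def)
  have "(M * T) *\<^sub>v monomials k x = (T * M_aff k \<sigma> \<tau>) *\<^sub>v monomials k x" if x: "x \<in> {0..1}" for x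
  proof -
    have "w (x, f x) \<in> graph_of f"
      using graph x by (auto simp: graph_of_def)
    moreover have "w (x, f x) = (l x, M *\<^sub>v f x)"
      using w_eq[OF x funcset_mem[OF f_maps x]] by (simp add: l_def)
    \<comment> \<open>A point of the graph is determined by its first coordinate, here
      \<open>l x\<close>.\<close>
    ultimately have "M *\<^sub>v f x = f (l x)"
      by (auto simp: graph_of_def)
    \<comment> \<open>\<open>T_eq\<close> is used at \<open>x\<close> and at \<open>l x\<close>; the
      latter is permitted because \<open>l\<close> maps the unit interval into itself.\<close>
    then have "M *\<^sub>v (T *\<^sub>v monomials k x) = T *\<^sub>v (M_aff k \<sigma> \<tau> *\<^sub>v monomials k x)"
      using T_eq x l_unit[OF x] by (simp add: M_aff_mult_monomials l_def)
    then show ?thesis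
      using M T
      by (simp add: assoc_mult_mat_vec[OF _ _ monomials_carrier]
          assoc_mult_mat_vec[OF T M_aff_carrier monomials_carrier])
  qed
  then have "M * T = T * M_aff k \<sigma> \<tau>"
    using mat_eq_if_mult_monomials_eq[OF mult_carrier_mat[OF M T] mult_carrier_mat[OF T M_aff_carrier],
        of "{0..1}"] by simp
  moreover have "M = M * T * inv_mat T"
    using assoc_mult_mat[OF M T inv_mat_GL(1)[OF T_GL]] inv_mat_GL(2)[OF T_GL] M by simp
  ultimately have M_eq: "M = T * M_aff k \<sigma> \<tau> * inv_mat T"
    by simp
  show ?thesis
    by (intro bexI[OF _ l] exI[of _ \<sigma>] exI[of _ \<tau>] conjI allI ballI)
      (simp_all only: l_def w_eq M_eq)
qed

end
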